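(* Let $n\ge 2$, let $a\in C_n\cap\mathbb{R}^n_{\ge 0}$, and let $\mathcal{P}:(-\infty,\frac{a_n^2}{2}]\to\mathbb{R}^n$ be the solution path of $a$. Then: (A1) The solution path $\mathcal{P}$ is continuous. (A2) $\mathcal{P}(0)=a$ and $\mathcal{P}\bigl(\frac{a_n^2}{2}\bigr)=\bar a:=(a_1,\dots,a_{n-1},0)$. (A3) $\mathcal{P}(\lambda)\in C_n$ for all $\lambda\in(-\infty,\frac{a_n^2}{2}]$. (A4) For any $\lambda\in(-\infty,\frac{a_n^2}{2}]$ with $\operatorname{prod}(\mathcal{P}(\lambda))=1$, the point $\mathcal{P}(\lambda)$ is a stationary point of the squared distance $d_a$ on $\mathrm{sl}(n)$. (A5) For $\lambda\le 0$, the map $\lambda\mapsto\operatorname{prod}(\mathcal{P}(\lambda))$ is strictly monotone decreasing, and $\lim_{\lambda\to-\infty}\operatorname{prod}(\mathcal{P}(\lambda))=\infty$.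
   Context: $\mathbb{R}^n_{\ge 0}=\{x\in\mathbb{R}^n : x_i\ge 0 \text{ for all } i\}$; $\operatorname{prod}(x)=\prod_{i=1}^n x_i$; $\mathrm{sl}(n)=\{x\in\mathbb{R}^n:\operatorname{prod}(x)=1\}$; the order cone is $C_n=\{x\in\mathbb{R}^n : x_1\ge x_2\ge\dots\ge x_n\}$; $d_a(p)=\frac12\|p-a\|_2^2$. A point $p\in\mathrm{sl}(n)$ is a stationary point of $d_a$ on $\mathrm{sl}(n)$ if there is a $\mu\in\mathbb{R}$ with $p_i-a_i+\mu p_i^{-1}=0$ for all $i=1,\dots,n$. The positive and negative branches of the solution path are the maps $\mathcal{P}^+:(-\infty,\frac{a_n^2}{4}]\to\mathbb{R}^n$, $\mathcal{P}^+(\lambda)_i=\frac{a_i}{2}+\sqrt{\frac{a_i^2}{4}-\lambda}$ for $i=1,\dots,n$, and $\mathcal{P}^-:[0,\frac{a_n^2}{4}]\to\mathbb{R}^n$, $\mathcal{P}^-(\lambda)_i=\frac{a_i}{2}+\sqrt{\frac{a_i^2}{4}-\lambda}$ for $i=1,\dots,n-1$ and $\mathcal{P}^-(\lambda)_n=\frac{a_n}{2}-\sqrt{\frac{a_n^2}{4}-\lambda}$. The solution path is $\mathcal{P}:(-\infty,\frac{a_n^2}{2}]\to\mathbb{R}^n$ with $\mathcal{P}(\lambda)=\mathcal{P}^+(\lambda)$ if $\lambda<\frac{a_n^2}{4}$ and $\mathcal{P}(\lambda)=\mathcal{P}^-\bigl(\frac{a_n^2}{2}-\lambda\bigr)$ if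 $\lambda\ge\frac{a_n^2}{4}$. *)

theory Defs
  imports "HOL-Analysis.Analysis"
begin

text \<open>
  The index set \<open>{1,\<dots>,n}\<close> is modelled by a finite linearly ordered type \<open>'n\<close> with
  \<open>CARD('n) = n\<close>; it is order-isomorphic to \<open>{1,\<dots>,n}\<close>, and the index \<open>n\<close> is its
  greatest element.
\<close>

definition last_index :: "'n::{finite,linorder}" where
  "last_index = Max UNIV"

definition nonneg_orthant :: "(real ^ 'n) set" where
  "nonneg_orthant = {x. \<forall>i. 0 \<le> x $ i}"

definition order_cone :: "(real ^ 'n::{finite,linorder}) set" where
  "order_cone = {x. \<forall>i j. i \<le> j \<longrightarrow> x $ j \<le> x $ i}"

definition coord_prod :: "real ^ 'n \<Rightarrow> real" where
  "coord_prod x = (\<Prod>i\<in>UNIV. x $ i)"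

definition sl :: "(real ^ 'n) set" where
  "sl = {x. coord_prod x = 1}"

text \<open>
  Stationary points of \<open>d\<^sub>a(p) = \<parallel>p - a\<parallel>\<^sup>2 / 2\<close> on \<open>sl\<close>, by the Lagrange condition:
  \<open>p $ i - a $ i\<close> is the \<open>i\<close>-th partial derivative of \<open>d\<^sub>a\<close> at \<open>p\<close>, and \<open>inverse (p $ i)\<close>
  is that of \<open>coord_prod\<close> at a point where \<open>coord_prod p = 1\<close>.
\<close>

definition stationary_point :: "real ^ 'n \<Rightarrow> real ^ 'n \<Rightarrow> bool" where
  "stationary_point a p \<longleftrightarrow>
     p \<in> sl \<and> (\<exists>\<mu>::real. \<forall>i. p $ i - a $ i + \<mu> * inverse (p $ i) = 0)"

text \<open>
  The branches and the path are total functions here; they carry their intended meaning only on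
  \<open>{..a\<^sub>n\<^sup>2/4}\<close>, \<open>{0..a\<^sub>n\<^sup>2/4}\<close> and \<open>{..a\<^sub>n\<^sup>2/2}\<close>, respectively. For \<open>a\<close> in the order cone and
  the nonnegative orthant, all radicands are nonnegative on these domains.
\<close>

definition pos_branch :: "real ^ 'n \<Rightarrow> real \<Rightarrow> real ^ 'n" where
  "pos_branch a l = (\<chi> i. a $ i / 2 + sqrt ((a $ i)\<^sup>2 / 4 - l))"

definition neg_branch :: "real ^ 'n::{finite,linorder} \<Rightarrow> real \<Rightarrow> real ^ 'n::{finite,linorder}" where
  "neg_branch a l =
     (\<chi> i. if i = last_index then a $ i / 2 - sqrt ((a $ i)\<^sup>2 / 4 - l)
          else a $ i / 2 + sqrt ((a $ i)\<^sup>2 / 4 - l))"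

definition path_end :: "real ^ 'n::{finite,linorder} \<Rightarrow> real" where
  "path_end a = (a $ last_index)\<^sup>2 / 2"

definition solution_path :: "real ^ 'n::{finite,linorder} \<Rightarrow> real \<Rightarrow> real ^ 'n::{finite,linorder}" where
  "solution_path a l =
     (if l < (a $ last_index)\<^sup>2 / 4 then pos_branch a l
      else neg_branch a ((a $ last_index)\<^sup>2 / 2 - l))"

end

theory Submission
  imports Defs
begin

text \<open>
  Every coordinate of a point of the path is a root of \<open>x\<^sup>2 - a\<^sub>i x + \<lambda>' = 0\<close> with one and the same
  \<open>\<lambda>'\<close>. Dividing by \<open>x\<close> gives the Lagrange condition with multiplier \<open>\<lambda>'\<close>. The two branches agree
  where they meet because there the radicand of the last coordinate vanishes. For \<open>\<lambda> \<le> 0\<close> all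
  coordinates are nonnegative, strictly decreasing in \<open>\<lambda>\<close> and at least \<open>sqrt (- \<lambda>)\<close>.
\<close>

lemma le_last_index: "i \<le> (last_index :: 'n::{finite,linorder})"
  by (simp add: last_index_def)

lemma pos_branch_nth [simp]: "pos_branch a l $ i = a $ i / 2 + sqrt ((a $ i)\<^sup>2 / 4 - l)"
  by (simp add: pos_branch_def)

lemma neg_branch_nth [simp]:
  "neg_branch a l $ i = (if i = last_index then a $ i / 2 - sqrt ((a $ i)\<^sup>2 / 4 - l)
     else a $ i / 2 + sqrt ((a $ i)\<^sup>2 / 4 - l))"
  by (simp add: neg_branch_def)

lemma branches_meet:
  "l = (a $ last_index)\<^sup>2 / 4 \<Longrightarrow> neg_branch a l = pos_branch a l"
  by (simp add: vec_eq_iff)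

text \<open>The definition switches formula with a strict inequality. Since the branches agree at
  the switching point, each formula is valid on a closed half-line, as gluing requires.\<close>

lemma solution_path_eq_pos_branch:
  "l \<le> (a $ last_index)\<^sup>2 / 4 \<Longrightarrow> solution_path a l = pos_branch a l"
  using branches_meet[of l a] by (auto simp: solution_path_def not_less)

lemma solution_path_eq_neg_branch:
  "(a $ last_index)\<^sup>2 / 4 \<le> l \<Longrightarrow>
     solution_path a l = neg_branch a ((a $ last_index)\<^sup>2 / 2 - l)"
  by (simp add: solution_path_def)

text \<open>Any \<open>S\<close> is allowed because \<open>sqrt\<close> is continuous on all of the
  reals, extended to negative arguments as an odd function.\<close>

lemma continuous_on_pos_branch: "continuous_on S (pos_branch a)"
  unfolding pos_branch_def by (intro continuous_intros)

lemma continuous_on_neg_branch: "continuous_on S (neg_branch a)"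
proof -
  have "continuous_on S (\<lambda>l. neg_branch a l $ i)" for i
    by (cases "i = last_index") (auto intro!: continuous_intros)
  then have "continuous_on S (\<lambda>l. \<chi> i. neg_branch a l $ i)"
    by (rule continuous_on_vec_lambda)
  then show ?thesis
    by (simp only: vec_lambda_eta)
qed

lemma continuous_on_solution_path: "continuous_on S (solution_path a)"
proof -
  let ?c = "(a $ last_index)\<^sup>2 / 4"
  have "continuous_on {..?c} (solution_path a)"
    by (rule continuous_on_eq[OF continuous_on_pos_branch])
      (simp add: solution_path_eq_pos_branch)
  moreover have "continuous_on {?c..} (solution_path a)"
  proof (rule continuous_on_eq)
    show "continuous_on {?c..} (\<lambda>l. neg_branch a ((a $ last_index)\<^sup>2 / 2 - l))"
      by (rule continuous_on_compose2[OF continuous_on_neg_branch[of UNIV]])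
        (auto intro!: continuous_intros)
  qed (simp add: solution_path_eq_neg_branch)
  \<comment> \<open>Pasting along two closed half-lines, which together cover the whole real
    line.\<close>
  ultimately have "continuous_on ({..?c} \<union> {?c..}) (solution_path a)"
    by (intro continuous_on_closed_Un) auto
  then show ?thesis
    by (rule continuous_on_subset) auto
qed

lemma quadratic_roots:
  fixes b l s :: real
  assumes "l \<le> b\<^sup>2 / 4" and "s = sqrt (b\<^sup>2 / 4 - l)"
  shows "(b / 2 + s)\<^sup>2 - b * (b / 2 + s) + l = 0" and "(b / 2 - s)\<^sup>2 - b * (b / 2 - s) + l = 0"
proof -
  have "s\<^sup>2 = b\<^sup>2 / 4 - l"
    using assms by simp
  then show "(b / 2 + s)\<^sup>2 - b * (b / 2 + s) + l = 0" "(b / 2 - s)\<^sup>2 - b * (b / 2 - s) + l = 0"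
    by (simp_all add: power2_eq_square algebra_simps)
qed

text \<open>The constant term \<open>l\<close> common to all the quadratics is the multiplier. A
  product equal to 1 excludes zero coordinates, so each quadratic may be divided by
  \<open>p $ i\<close>.\<close>

lemma stationary_pointI:
  assumes "coord_prod p = 1" and root: "\<And>i. (p $ i)\<^sup>2 - a $ i * p $ i + l = 0"
  shows "stationary_point a p"
proof -
  have "p $ i - a $ i + l * inverse (p $ i) = 0" for i
  proof -
    have "p $ i \<noteq> 0"
      using assms(1) by (metis coord_prod_def finite UNIV_I prod_zero_iff zero_neq_one)
    then show ?thesis
      using root[of i] by (simp add: field_simps power2_eq_square)
  qed
  with assms(1) show ?thesis
    by (auto simp: stationary_point_def sl_def)
qed

text \<open>The last coordinate has the smallest radicand, so a bound on the parameter in terms of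
  it makes all radicands nonnegative.\<close>

lemma cone_last_sq_le:
  assumes "a \<in> order_cone \<inter> nonneg_orthant"
  shows "(a $ last_index)\<^sup>2 \<le> (a $ i)\<^sup>2"
  using assms le_last_index by (auto simp: order_cone_def nonneg_orthant_def intro: power_mono)

lemma solution_path_roots:
  assumes a: "a \<in> order_cone \<inter> nonneg_orthant"
  obtains m where "\<And>i. (solution_path a l $ i)\<^sup>2 - a $ i * solution_path a l $ i + m = 0"
proof (cases "l \<le> (a $ last_index)\<^sup>2 / 4")
  case True
  show thesis
  proof
    fix i
    have "l \<le> (a $ i)\<^sup>2 / 4"
      using True cone_last_sq_le[OF a, of i] by simp
    then show "(solution_path a l $ i)\<^sup>2 - a $ i * solution_path a l $ i + l = 0"
      using quadratic_roots(1)[OF _ refl] by (simp add: solution_path_eq_pos_branch[OF True])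
  qed
next
  case False
  \<comment> \<open>This is \<open>l\<close> reflected at the switching point, hence
    \<open>m\<close> lies below that point.\<close>
  define m where "m = (a $ last_index)\<^sup>2 / 2 - l"
  have path: "solution_path a l = neg_branch a m"
    using False by (simp add: m_def solution_path_eq_neg_branch)
  show thesis
  proof
    fix i
    have "m \<le> (a $ i)\<^sup>2 / 4"
      using False cone_last_sq_le[OF a, of i] by (simp add: m_def)
    then show "(solution_path a l $ i)\<^sup>2 - a $ i * solution_path a l $ i + m = 0"
      using quadratic_roots[OF _ refl, of m "a $ i"] by (auto simp: path)
  qed
qed

text \<open>For fixed \<open>l\<close>, the map t \<mapsto> t/2 + sqrt (t*t/4 - l) is nondecreasing
  on t \<ge> 0, as \<open>sqrt\<close> is monotone on all reals.\<close>

lemma pos_branch_in_order_cone: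
  assumes "a \<in> order_cone \<inter> nonneg_orthant"
  shows "pos_branch a l \<in> order_cone"
  using assms
  by (auto simp: order_cone_def nonneg_orthant_def
      intro!: add_mono divide_right_mono real_sqrt_le_mono diff_right_mono power_mono)

text \<open>Compared with the positive branch, only the last coordinate changes, and it moves down;
  being the smallest already, it keeps the order intact.\<close>

lemma neg_branch_in_order_cone:
  assumes a: "a \<in> order_cone \<inter> nonneg_orthant" and "l \<le> (a $ last_index)\<^sup>2 / 4"
  shows "neg_branch a l \<in> order_cone"
proof -
  have "neg_branch a l $ j \<le> neg_branch a l $ i" if "i \<le> j" for i j
  proof (cases "i = last_index")
    case True
    with that have "j = last_index"
      by (simp add: le_last_index order.antisym)
    with True show ?thesis by simp
  next
    case False
    \<comment> \<open>For a negative radicand \<open>sqrt\<close> would be negative, and flipping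
      its sign would raise the coordinate.\<close>
    have "0 \<le> (a $ j)\<^sup>2 / 4 - l"
      using assms(2) cone_last_sq_le[OF a, of j] by simp
    then have "neg_branch a l $ j \<le> pos_branch a l $ j"
      by auto
    also have "\<dots> \<le> pos_branch a l $ i"
      using pos_branch_in_order_cone[OF a] that unfolding order_cone_def by blast
    finally show ?thesis
      using False by simp
  qed
  then show ?thesis by (simp add: order_cone_def)
qed

lemma pos_branch_zero: "a \<in> nonneg_orthant \<Longrightarrow> pos_branch a 0 = a"
  by (simp add: vec_eq_iff nonneg_orthant_def real_sqrt_divide)

lemma neg_branch_zero:
  "a \<in> nonneg_orthant \<Longrightarrow> neg_branch a 0 = (\<chi> i. if i = last_index then 0 else a $ i)"
  by (simp add: vec_eq_iff nonneg_orthant_def real_sqrt_divide)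

lemma
  assumes "a \<in> nonneg_orthant" and "l \<le> 0"
  shows pos_branch_nonneg: "0 \<le> pos_branch a l $ i"
    and sqrt_le_pos_branch: "sqrt (- l) \<le> pos_branch a l $ i"
proof -
  have "0 \<le> a $ i / 2" and "sqrt (- l) \<le> sqrt ((a $ i)\<^sup>2 / 4 - l)"
    using assms by (auto simp: nonneg_orthant_def)
  then show "sqrt (- l) \<le> pos_branch a l $ i"
    unfolding pos_branch_nth by linarith
  then show "0 \<le> pos_branch a l $ i"
    using assms(2) real_sqrt_ge_zero[of "- l"] by linarith
qed

lemma coord_prod_pos_branch_strict_antimono:
  fixes a :: "real ^ 'n"
  assumes "a \<in> nonneg_orthant"
  shows "strict_antimono_on {..0} (\<lambda>l. coord_prod (pos_branch a l))"
proof (rule monotone_onI)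
  fix l m :: real
  assume "m \<in> {..0}" and "l < m"
  then have "0 \<le> pos_branch a m $ i" and "pos_branch a m $ i < pos_branch a l $ i" for i
    using pos_branch_nonneg[OF assms] by auto
  then show "coord_prod (pos_branch a m) < coord_prod (pos_branch a l)"
    \<comment> \<open>Coordinates at \<open>m\<close> may vanish when \<open>m = 0\<close>, but
      those at \<open>l\<close> are strictly larger and hence positive, so the product inequality
      stays strict.\<close>
    unfolding coord_prod_def
    by (intro prod_mono_strict) (auto intro: less_imp_le le_less_trans simp del: pos_branch_nth)
qed

lemma coord_prod_pos_branch_at_bot:
  fixes a :: "real ^ 'n"
  assumes "a \<in> nonneg_orthant"
  shows "filterlim (\<lambda>l. coord_prod (pos_branch a l)) at_top at_bot"
proof (rule filterlim_at_top_mono)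
  show "filterlim (\<lambda>l::real. sqrt (- l) ^ CARD('n)) at_top at_bot"
    by (intro filterlim_pow_at_top filterlim_compose[OF sqrt_at_top]
        filterlim_uminus_at_top_at_bot) simp
  have "sqrt (- l) ^ CARD('n) \<le> coord_prod (pos_branch a l)" if "l \<le> 0" for l
    using prod_mono[of UNIV "\<lambda>_. sqrt (- l)" "\<lambda>i. pos_branch a l $ i"]
      sqrt_le_pos_branch[OF assms that] that
    by (simp add: coord_prod_def)
  then show "\<forall>\<^sub>F l in at_bot. sqrt (- l) ^ CARD('n) \<le> coord_prod (pos_branch a l)"
    using eventually_le_at_bot[of "0::real"] by (rule eventually_mono[rotated])
qed

theorem lemma3p10:
  fixes a :: "real ^ 'n::{finite,linorder}"
  assumes "CARD('n) \<ge> 2"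
    and "a \<in> order_cone \<inter> nonneg_orthant"
  shows "continuous_on {..path_end a} (solution_path a) \<and>
    (solution_path a 0 = a \<and>
     solution_path a (path_end a) = (\<chi> i. if i = last_index then 0 else a $ i)) \<and>
    (\<forall>l\<in>{..path_end a}. solution_path a l \<in> order_cone) \<and>
    (\<forall>l\<in>{..path_end a}. coord_prod (solution_path a l) = 1 \<longrightarrow>
       stationary_point a (solution_path a l)) \<and>
    (strict_antimono_on {..0} (\<lambda>l. coord_prod (solution_path a l)) \<and>
     filterlim (\<lambda>l. coord_prod (solution_path a l)) at_top at_bot)"
proof (intro conjI ballI impI)
  have orth: "a \<in> nonneg_orthant"
    using assms(2) by blast
  have pos: "solution_path a l = pos_branch a l" if "l \<le> 0" for l
    using that by (intro solution_path_eq_pos_branch) (rule order.trans, auto)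
  show "continuous_on {..path_end a} (solution_path a)"
    by (rule continuous_on_solution_path)
  show "solution_path a 0 = a"
    by (simp add: pos pos_branch_zero orth)
  \<comment> \<open>At the end of the path the reflected parameter of the negative branch is
    0.\<close>
  show "solution_path a (path_end a) = (\<chi> i. if i = last_index then 0 else a $ i)"
    using neg_branch_zero[OF orth] by (simp add: path_end_def solution_path_eq_neg_branch)
  show "solution_path a l \<in> order_cone" for l
    using assms(2) by (auto simp: solution_path_def pos_branch_in_order_cone
        intro!: neg_branch_in_order_cone)
  show "stationary_point a (solution_path a l)"
    if "l \<in> {..path_end a}" "coord_prod (solution_path a l) = 1" for l
    using solution_path_roots[OF assms(2)] stationary_pointI[OF that(2)] by metis
  show "strict_antimono_on {..0} (\<lambda>l. coord_prod (solution_path a l))"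
    using coord_prod_pos_branch_strict_antimono[OF orth] by (simp add: monotone_on_def pos)
  \<comment> \<open>Agreement for \<open>l \<le> 0\<close> suffices to transfer a limit at
    \<open>at_bot\<close>.\<close>
  have "\<forall>\<^sub>F l in at_bot. coord_prod (pos_branch a l) = coord_prod (solution_path a l)"
    using eventually_le_at_bot[of "0::real"] by (rule eventually_mono) (simp add: pos)
  then show "filterlim (\<lambda>l. coord_prod (solution_path a l)) at_top at_bot"
    using coord_prod_pos_branch_at_bot[OF orth] by (simp cong: filterlim_cong)
qed

end
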